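(* Let $\alpha>0$ and $\beta\le 0$ be real numbers, and let $f\in\mathcal{A}$ satisfy $f(z)f'(z)/z\neq 0$ for all $z\in\mathbb{D}$. If at least one of the following inequalities holds for all $z\in\mathbb{D}$: (i) $\operatorname{Re}\left(\alpha\dfrac{Q_{ST}}{Q_{CV}}+\beta\dfrac{Q_{SD}}{Q_{CV}}\right)>\dfrac{2\alpha}{3}$; (ii) $\operatorname{Re}\left(\alpha\dfrac{Q_{ST}}{Q_{CV}}+\beta\dfrac{Q_{SD}}{Q_{ST}}\right)>\dfrac{2\alpha}{3}$; then $f$ is starlike.
   Context: $\mathbb{D}=\{z\in\mathbb{C}:|z|<1\}$. $\mathcal{A}$ is the class of analytic functions $f:\mathbb{D}\to\mathbb{C}$ with $f(0)=0$ and $f'(0)=1$. For $f\in\mathcal{A}$, as functions of $z\in\mathbb{D}$: $Q_{ST}=zf'(z)/f(z)$ (with the removable singularity at $z=0$ filled in, value $1$), $Q_{CV}=1+zf''(z)/f'(z)$, and $Q_{SD}=z^2\Big(\big(f''(z)/f'(z)\big)'-\tfrac12\big(f''(z)/f'(z)\big)^2\Big)$ ($z^2$ times the Schwarzian derivative of $f$). The condition $f(z)f'(z)/z\neq0$ is understood at $z=0$ via the removable singularity (where the value is $1$). An inequality containing a quotient is understood to include the requirement that the denominators appearing in it do not vanish in $\mathbb{D}$. A function $f\in\mathcal{A}$ is starlike if $\operatorname{Re}Q_{ST}>0$ on $\mathbb{D}$; equivalently, $f$ is univalent and $tf(z)\in f(\mathbb{D})$ for all $z\in\mathbb{D}$,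 $t\in[0,1]$. *)

theory Defs
  imports "HOL-Complex_Analysis.Complex_Analysis"
begin

text \<open>Functions on the unit disc are total functions on the complex plane of which only the
  values on \<open>ball 0 1\<close> matter; since the disc is open, \<open>deriv\<close> is the derivative there.\<close>

definition normalized_analytic :: "(complex \<Rightarrow> complex) set" where
  "normalized_analytic = {f. f holomorphic_on ball 0 1 \<and> f 0 = 0 \<and> deriv f 0 = 1}"

text \<open>The value at 0 fills in the removable singularity of \<open>z f'(z) / f(z)\<close>,
  for normalized \<open>f\<close>.\<close>

definition Q_ST :: "(complex \<Rightarrow> complex) \<Rightarrow> complex \<Rightarrow> complex" where
  "Q_ST f z = (if z = 0 then 1 else z * deriv f z / f z)"

definition Q_CV :: "(complex \<Rightarrow> complex) \<Rightarrow> complex \<Rightarrow> complex" where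
  "Q_CV f z = 1 + z * deriv (deriv f) z / deriv f z"

definition schwarzian :: "(complex \<Rightarrow> complex) \<Rightarrow> complex \<Rightarrow> complex" where
  "schwarzian f z = deriv (\<lambda>w. deriv (deriv f) w / deriv f w) z
     - (1 / 2) * (deriv (deriv f) z / deriv f z)\<^sup>2"

definition Q_SD :: "(complex \<Rightarrow> complex) \<Rightarrow> complex \<Rightarrow> complex" where
  "Q_SD f z = z\<^sup>2 * schwarzian f z"

text \<open>\<open>f(z) f'(z) / z\<close>, again with its limit for normalized \<open>f\<close> filled in at 0.\<close>

definition ff'_over_z :: "(complex \<Rightarrow> complex) \<Rightarrow> complex \<Rightarrow> complex" where
  "ff'_over_z f z = (if z = 0 then 1 else f z * deriv f z / z)"

text \<open>Because division by 0 yields 0, positivity of the real part forces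
  \<open>f\<close> to be nonzero on the punctured disc.\<close>

definition starlike_function :: "(complex \<Rightarrow> complex) \<Rightarrow> bool" where
  "starlike_function f \<longleftrightarrow> f \<in> normalized_analytic \<and> (\<forall>z \<in> ball 0 1. Re (Q_ST f z) > 0)"

end

theory Submission
  imports Defs
begin

text \<open>
  Write \<open>p = Q_ST f\<close>. By the hypothesis that \<open>f f' / z\<close> has no zeros, \<open>p\<close> is holomorphic and
  zero-free on the disc, with \<open>p 0 = 1\<close>. Suppose \<open>f\<close> is not starlike, and follow the growing discs
  about 0 up to the first radius at which \<open>Re p\<close> fails to be positive. At a point \<open>z\<close> where this
  happens (lemma \<open>least_modulus_boundary_point\<close>), \<open>p z = \<i> s\<close> is imaginary, and nonzero.
  The behaviour of \<open>Re p\<close> near \<open>z\<close> is constrained in two directions.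

  \<^item> Along the circle through \<open>z\<close>, \<open>Re p\<close> has a minimum at \<open>z\<close>. The first derivative in the angle
    vanishes, so \<open>t = z p'(z)\<close> is real; the second is nonnegative, so \<open>r = z p'(z) + z\<^sup>2 p''(z)\<close>
    satisfies \<open>Re r \<le> 0\<close> (lemma \<open>boundary_point_angular\<close>).

  \<^item> Along the radius ending at \<open>z\<close>, the Schwarz lemma gives a lower bound for \<open>Re p\<close> that is attained
    at \<open>z\<close>; comparing slopes, \<open>t \<le> - (1 + s\<^sup>2) / 2\<close> (lemma \<open>boundary_point_radial\<close>).

  Logarithmic differentiation expresses the other quantities through \<open>p\<close>:
  \<open>Q_CV f = p + z p' / p\<close> and \<open>Q_SD f = z (Q_CV f)' + (1 - (Q_CV f)\<^sup>2) / 2\<close>. At the point \<open>z\<close>,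
  \<open>Q_CV f z = \<i> (s\<^sup>2 - t) / s\<close> is imaginary too, and \<open>Q_SD f z\<close> is a real number minus \<open>\<i> r / s\<close>.
  Dividing the real number by an imaginary one contributes nothing to the real part, hence
  \<open>Re (Q_SD / Q_CV) = - Re r / (s\<^sup>2 - t) \<ge> 0\<close> and \<open>Re (Q_SD / Q_ST) = - Re r / s\<^sup>2 \<ge> 0\<close>, while
  \<open>Q_ST / Q_CV = s\<^sup>2 / (s\<^sup>2 - t) \<le> 2 s\<^sup>2 / (3 s\<^sup>2 + 1) < 2 / 3\<close>. Since \<open>\<alpha> > 0\<close> and \<open>\<beta> \<le> 0\<close>, both
  inequalities of the theorem fail at \<open>z\<close>.
\<close>

section \<open>Functions whose real part first vanishes on a circle\<close>

lemma second_derivative_nonneg_at_minimum: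
  fixes \<phi> :: "real \<Rightarrow> real"
  assumes \<phi>: "\<And>x. (\<phi> has_real_derivative \<phi>' x) (at x)"
    and \<phi>': "(\<phi>' has_real_derivative D) (at a)"
    and min: "\<And>x. \<phi> a \<le> \<phi> x"
  shows "0 \<le> D"
proof (rule ccontr)
  assume "\<not> 0 \<le> D"
  then obtain d where d: "d > 0" "\<And>h. 0 < h \<Longrightarrow> h < d \<Longrightarrow> \<phi>' (a + h) < \<phi>' a"
    using DERIV_neg_dec_right[OF \<phi>'] by (auto simp: not_le)
  have "\<phi>' a = 0"
    by (rule DERIV_local_min[OF \<phi>, of 1]) (use min in auto)
  have "\<phi> (a + d / 2) < \<phi> a"
  proof (rule DERIV_neg_imp_decreasing_open[where f = \<phi>])
    fix x assume "a < x" "x < a + d / 2"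
    then have "\<phi>' x < 0"
      using d(2)[of "x - a"] \<open>\<phi>' a = 0\<close> by auto
    then show "\<exists>y. (\<phi> has_real_derivative y) (at x) \<and> y < 0"
      using \<phi>[of x] by (intro exI conjI)
  next
    show "continuous_on {a..a + d / 2} \<phi>"
      by (rule DERIV_continuous_on, rule has_field_derivative_at_within, rule \<phi>)
  qed (use d in auto)
  with min[of "a + d / 2"] show False by simp
qed

text \<open>
  The Cayley transform \<open>w = (1 - h) / (1 + h)\<close> maps the right half-plane to the disc and \<open>1\<close> to \<open>0\<close>,
  so the Schwarz lemma gives \<open>norm (w z) \<le> norm z\<close>. The stated form, with the denominator of \<open>w\<close>
  cleared, is a polynomial in \<open>Re (h z)\<close>, \<open>Im (h z)\<close> and \<open>norm z\<close> and thus easy to differentiate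
  along a radius.
\<close>

lemma positive_real_part_schwarz:
  assumes h: "h holomorphic_on ball 0 1" "h 0 = 1"
    and pos: "\<And>z. norm z < 1 \<Longrightarrow> Re (h z) > 0"
    and z: "norm z < 1"
  shows "(1 - (norm z)\<^sup>2) * (norm (1 + h z))\<^sup>2 \<le> 4 * Re (h z)"
proof -
  define w where "w = (\<lambda>z. (1 - h z) / (1 + h z))"
  have identity: "(norm (1 + h z))\<^sup>2 - (norm (1 - h z))\<^sup>2 = 4 * Re (h z)" for z
    unfolding cmod_power2 by (simp add: power2_eq_square algebra_simps)
  have nonzero: "1 + h z \<noteq> 0" if "norm z < 1" for z
  proof
    assume "1 + h z = 0"
    then have "Re (1 + h z) = 0" by simp
    with pos[OF that] show False by simp
  qed
  have "norm (w z) \<le> norm z"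
  proof (rule Schwarz_Lemma(1))
    show "w holomorphic_on ball 0 1"
      unfolding w_def using h(1) nonzero by (intro holomorphic_intros) auto
    show "w 0 = 0" by (simp add: w_def h(2))
  next
    fix z :: complex assume z: "norm z < 1"
    have "(norm (1 - h z))\<^sup>2 < (norm (1 + h z))\<^sup>2"
      using identity[of z] pos[OF z] by linarith
    then have "norm (1 - h z) < norm (1 + h z)"
      by (rule power_less_imp_less_base) simp
    then show "norm (w z) < 1"
      using nonzero[OF z] by (simp add: w_def norm_divide)
  qed (fact z)
  then have "norm (1 - h z) \<le> norm z * norm (1 + h z)"
    using nonzero[OF z] by (simp add: w_def norm_divide divide_simps)
  then have "(norm (1 - h z))\<^sup>2 \<le> (norm z)\<^sup>2 * (norm (1 + h z))\<^sup>2"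
    by (metis norm_ge_zero power_mono power_mult_distrib)
  with identity[of z] show ?thesis by (simp add: algebra_simps)
qed

text \<open>
  Compactness of \<open>Re p \<le> 0\<close> in the closed disc through \<open>z1\<close> provides a point of least modulus in it.
  Then \<open>Re p\<close> is positive on the open disc through that point, hence nonnegative on the closed one,
  which forces equality at the point itself.
\<close>

lemma least_modulus_boundary_point:
  assumes p: "p holomorphic_on ball 0 1" "Re (p 0) > 0"
    and z1: "z1 \<in> ball 0 1" "Re (p z1) \<le> 0"
  obtains z0 where "z0 \<in> ball 0 1" "z0 \<noteq> 0" "Re (p z0) = 0"
    and "\<And>z. norm z < norm z0 \<Longrightarrow> Re (p z) > 0"
    and "\<And>z. norm z \<le> norm z0 \<Longrightarrow> Re (p z) \<ge> 0"
proof -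
  have cont: "continuous_on (cball 0 r) (\<lambda>z. Re (p z))" if "r < 1" for r
    by (intro continuous_intros holomorphic_on_imp_continuous_on holomorphic_on_subset[OF p(1)])
       (use that in auto)
  define K where "K = {z \<in> cball 0 (norm z1). Re (p z) \<le> 0}"
  have "compact K"
  proof -
    have "closed K"
      unfolding K_def
      by (intro continuous_on_closed_Collect_le cont continuous_intros)
         (use z1 in auto)
    moreover have "K \<subseteq> cball 0 (norm z1)" by (auto simp: K_def)
    ultimately show ?thesis
      using bounded_subset compact_eq_bounded_closed bounded_cball by blast
  qed
  moreover have "K \<noteq> {}" using z1 by (auto simp: K_def)
  ultimately obtain z0 where z0: "z0 \<in> K" "\<And>z. z \<in> K \<Longrightarrow> norm z0 \<le> norm z"
    using continuous_attains_inf[of K norm] by (auto intro: continuous_intros)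
  have small: "norm z0 \<le> norm z1" "norm z0 < 1"
    using z0(1) z1 by (auto simp: K_def)
  have inside: "Re (p z) > 0" if "norm z < norm z0" for z
    using z0(2)[of z] that small by (fastforce simp: K_def)
  have "z0 \<noteq> 0" using z0(1) p(2) by (auto simp: K_def)
  have closed: "Re (p z) \<ge> 0" if "norm z \<le> norm z0" for z
  proof (rule continuous_ge_on_closure[where S = "ball 0 (norm z0)" and f = "\<lambda>z. Re (p z)"])
    show "continuous_on (closure (ball 0 (norm z0))) (\<lambda>z. Re (p z))"
      using cont[OF small(2)] \<open>z0 \<noteq> 0\<close> by simp
    show "z \<in> closure (ball 0 (norm z0))" using that \<open>z0 \<noteq> 0\<close> by simp
  qed (use inside less_imp_le in auto)
  have "Re (p z0) = 0"
    using z0(1) closed[of z0] by (auto simp: K_def)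
  then show ?thesis
    using that[of z0] small \<open>z0 \<noteq> 0\<close> inside closed by auto
qed

text \<open>
  The inequality \<open>positive_real_part_schwarz\<close>, for \<open>p\<close> rescaled from the disc through \<open>z0\<close> to the unit
  disc, holds on the radius ending at \<open>z0\<close>. It becomes an equality at \<open>z0\<close>, where both sides vanish.
  So the difference \<open>G\<close> of the two sides is nonnegative before the endpoint \<open>\<rho> = 1\<close> and zero there:
  its slope at \<open>1\<close>, which is \<open>4 Re (z0 p'(z0)) + 2 (1 + (Im (p z0))\<^sup>2)\<close>, cannot be positive.
\<close>

lemma boundary_point_radial:
  assumes p: "p holomorphic_on ball 0 1" "p 0 = 1"
    and z0: "z0 \<in> ball 0 1" "Re (p z0) = 0"
    and inside: "\<And>z. norm z < norm z0 \<Longrightarrow> Re (p z) > 0"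
  shows "2 * Re (z0 * deriv p z0) \<le> - (1 + (Im (p z0))\<^sup>2)"
proof -
  define G where
    "G = (\<lambda>\<rho>. 4 * Re (p (of_real \<rho> * z0)) - (1 - \<rho>\<^sup>2) *
            ((1 + Re (p (of_real \<rho> * z0)))\<^sup>2 + (Im (p (of_real \<rho> * z0)))\<^sup>2))"
  have "z0 \<noteq> 0" using z0(2) p(2) by auto
  have "G \<rho> \<ge> 0" if "0 \<le> \<rho>" "\<rho> < 1" for \<rho>
  proof -
    have inball: "norm (z0 * z) < norm z0" if "norm z < 1" for z
      using that \<open>z0 \<noteq> 0\<close> by (simp add: norm_mult)
    have "(1 - (norm (of_real \<rho> :: complex))\<^sup>2) * (norm (1 + p (z0 * of_real \<rho>)))\<^sup>2
            \<le> 4 * Re (p (z0 * of_real \<rho>))"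
    proof (rule positive_real_part_schwarz[of "\<lambda>z. p (z0 * z)"])
      show "(\<lambda>z. p (z0 * z)) holomorphic_on ball 0 1"
      proof (rule holomorphic_on_compose_gen[OF _ p(1), unfolded o_def])
        show "(*) z0 ` ball 0 1 \<subseteq> ball 0 1"
          using inball z0(1) by force
      qed (intro holomorphic_intros)
    qed (use p inball inside that in auto)
    then show ?thesis using that by (simp add: G_def cmod_power2 mult.commute)
  qed
  moreover have "G 1 = 0" by (simp add: G_def z0)
  moreover have "(G has_real_derivative
      (4 * Re (z0 * deriv p z0) + 2 * (1 + (Im (p z0))\<^sup>2))) (at 1)"
  proof -
    have "((\<lambda>\<rho>. of_real \<rho> * z0) has_vector_derivative z0) (at 1)"
      by (auto intro!: derivative_eq_intros)
    moreover have "(p has_field_derivative deriv p z0) (at (of_real 1 * z0))"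
      using holomorphic_derivI[OF p(1) _ z0(1)] by simp
    ultimately have *: "((\<lambda>\<rho>. p (of_real \<rho> * z0)) has_vector_derivative z0 * deriv p z0) (at 1)"
      using field_vector_diff_chain_at[of "\<lambda>\<rho>. of_real \<rho> * z0" z0 1 p "deriv p z0"]
      by (simp add: o_def)
    show ?thesis
      unfolding G_def
      by (rule derivative_eq_intros has_field_derivative_Re[OF *] has_field_derivative_Im[OF *] refl
            | simp add: z0)+
  qed
  ultimately have "\<not> 4 * Re (z0 * deriv p z0) + 2 * (1 + (Im (p z0))\<^sup>2) > 0"
  proof (intro notI)
    assume "4 * Re (z0 * deriv p z0) + 2 * (1 + (Im (p z0))\<^sup>2) > 0"
      and G: "\<And>\<rho>. 0 \<le> \<rho> \<Longrightarrow> \<rho> < 1 \<Longrightarrow> 0 \<le> G \<rho>" "G 1 = 0"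
        "(G has_real_derivative 4 * Re (z0 * deriv p z0) + 2 * (1 + (Im (p z0))\<^sup>2)) (at 1)"
    from DERIV_pos_inc_left[OF G(3) this(1)] obtain d where
      d: "d > 0" "\<And>h. 0 < h \<Longrightarrow> h < d \<Longrightarrow> G (1 - h) < 0" using G(2) by auto
    have "0 < min 1 d / 2" "min 1 d / 2 < d" "min 1 d / 2 < 1" using d by auto
    with d(2)[of "min 1 d / 2"] G(1)[of "1 - min 1 d / 2"] show False by linarith
  qed
  then show ?thesis by (simp only: not_less) argo
qed

text \<open>
  Differentiating along the circle \<open>\<theta> \<mapsto> z0 cis \<theta>\<close> amounts to applying \<open>\<i> z d/dz\<close>. Twice applied to
  \<open>p\<close> this gives \<open>- z (z p')' = - (z p' + z\<^sup>2 p'')\<close>, so both claims are the usual necessary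
  conditions for a minimum of \<open>Re p\<close> on the circle.
\<close>

lemma boundary_point_angular:
  assumes p: "p holomorphic_on ball 0 1"
    and z0: "z0 \<in> ball 0 1"
    and min: "\<And>z. norm z = norm z0 \<Longrightarrow> Re (p z0) \<le> Re (p z)"
  shows "Im (z0 * deriv p z0) = 0"
    and "Re (z0 * deriv p z0 + z0\<^sup>2 * deriv (deriv p) z0) \<le> 0"
proof -
  define c where "c = (\<lambda>\<theta>. z0 * cis \<theta>)"
  define q where "q = (\<lambda>z. z * deriv p z)"
  have c: "(c has_vector_derivative \<i> * c \<theta>) (at \<theta>)" for \<theta>
    unfolding c_def
    by (auto intro!: derivative_eq_intros simp: algebra_simps has_vector_derivative_def scaleR_conv_of_real)
  have ball: "c \<theta> \<in> ball 0 1" for \<theta> using z0 by (simp add: c_def norm_mult)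
  have along: "((\<lambda>\<theta>. g (c \<theta>)) has_vector_derivative \<i> * c \<theta> * deriv g (c \<theta>)) (at \<theta>)"
    if "g holomorphic_on ball 0 1" for g \<theta>
    using field_vector_diff_chain_at[OF c holomorphic_derivI[OF that _ ball]] by (simp add: o_def)
  have q: "q holomorphic_on ball 0 1"
    unfolding q_def by (intro holomorphic_intros p) auto
  have d1: "((\<lambda>\<theta>. Re (p (c \<theta>))) has_real_derivative - Im (q (c \<theta>))) (at \<theta>)" for \<theta>
    using has_field_derivative_Re[OF along[OF p, of \<theta>]] by (simp add: q_def mult.assoc)
  have d2: "((\<lambda>\<theta>. - Im (q (c \<theta>))) has_real_derivative - Re (c 0 * deriv q (c 0))) (at 0)"
    using DERIV_minus[OF has_field_derivative_Im[OF along[OF q, of 0]]] by (simp add: mult.assoc)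
  have c0: "c 0 = z0" by (simp add: c_def)
  have minc: "Re (p (c 0)) \<le> Re (p (c \<theta>))" for \<theta>
    unfolding c0 by (rule min) (simp add: c_def norm_mult)
  have "- Im (q (c 0)) = 0"
    by (rule DERIV_local_min[OF d1, of 1]) (use minc in auto)
  then show "Im (z0 * deriv p z0) = 0" by (simp add: c0 q_def)
  have "0 \<le> - Re (c 0 * deriv q (c 0))"
    by (rule second_derivative_nonneg_at_minimum[OF d1 d2 minc])
  moreover have "deriv q z0 = deriv p z0 + z0 * deriv (deriv p) z0"
    unfolding q_def
    by (rule DERIV_imp_deriv)
       (auto intro!: derivative_eq_intros holomorphic_derivI[OF holomorphic_deriv[OF p] _ z0])
  ultimately show "Re (z0 * deriv p z0 + z0\<^sup>2 * deriv (deriv p) z0) \<le> 0"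
    by (simp add: c0 algebra_simps power2_eq_square)
qed

section \<open>The starlikeness, convexity and Schwarzian quotients\<close>

lemma f_nonzero:
  assumes "\<forall>z \<in> ball 0 1. ff'_over_z f z \<noteq> 0" "z \<in> ball 0 1" "z \<noteq> 0"
  shows "f z \<noteq> 0" "deriv f z \<noteq> 0"
  using bspec[OF assms(1,2)] assms(3) by (auto simp: ff'_over_z_def)

lemma deriv_f_nonzero:
  assumes "f \<in> normalized_analytic" "\<forall>z \<in> ball 0 1. ff'_over_z f z \<noteq> 0" "z \<in> ball 0 1"
  shows "deriv f z \<noteq> 0"
  using assms f_nonzero(2)[OF assms(2,3)] by (cases "z = 0") (auto simp: normalized_analytic_def)

text \<open>
  The function \<open>g z = f z / z\<close>, filled in with \<open>f'(0) = 1\<close>, is holomorphic and zero-free, and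
  \<open>Q_ST f = f' / g\<close> including at the origin.
\<close>

lemma Q_ST_holomorphic:
  assumes f: "f \<in> normalized_analytic" and ff': "\<forall>z \<in> ball 0 1. ff'_over_z f z \<noteq> 0"
  shows "Q_ST f holomorphic_on ball 0 1"
    and "\<And>z. z \<in> ball 0 1 \<Longrightarrow> Q_ST f z \<noteq> 0"
proof -
  define g where "g = (\<lambda>z. if z = 0 then 1 else f z / z)"
  have hol: "f holomorphic_on ball 0 1" and [simp]: "f 0 = 0" "deriv f 0 = 1"
    using f by (auto simp: normalized_analytic_def)
  have g: "g holomorphic_on ball 0 1"
    using pole_lemma_open[OF hol, of 0] by (simp add: g_def cong: if_cong)
  have nz: "z \<noteq> 0 \<Longrightarrow> f z \<noteq> 0" "deriv f z \<noteq> 0" if "z \<in> ball 0 1" for z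
    using f_nonzero(1)[OF ff' that] deriv_f_nonzero[OF f ff' that] by auto
  have "g z \<noteq> 0" if "z \<in> ball 0 1" for z
    using nz[OF that] by (simp add: g_def)
  then have "(\<lambda>z. deriv f z / g z) holomorphic_on ball 0 1"
    by (intro holomorphic_intros hol g) auto
  then show "Q_ST f holomorphic_on ball 0 1"
    by (rule holomorphic_transform) (auto simp: Q_ST_def g_def)
  show "Q_ST f z \<noteq> 0" if "z \<in> ball 0 1" for z
    using nz[OF that] by (simp add: Q_ST_def)
qed

text \<open>
  The logarithmic derivative of \<open>z f' / f\<close>, times \<open>z\<close>, is \<open>1 + z f'' / f' - z f' / f\<close>.
\<close>

lemma Q_CV_in_terms_of_Q_ST:
  assumes f: "f \<in> normalized_analytic" and ff': "\<forall>z \<in> ball 0 1. ff'_over_z f z \<noteq> 0"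
    and z: "z \<in> ball 0 1" "z \<noteq> 0"
  shows "Q_CV f z = Q_ST f z + z * deriv (Q_ST f) z / Q_ST f z"
proof -
  have hol: "f holomorphic_on ball 0 1"
    using f by (auto simp: normalized_analytic_def)
  have nz: "f z \<noteq> 0" "deriv f z \<noteq> 0"
    using f_nonzero[OF ff' z] by auto
  have "((\<lambda>z. z * deriv f z / f z) has_field_derivative
           ((deriv f z + z * deriv (deriv f) z) * f z - z * deriv f z * deriv f z) / (f z * f z)) (at z)"
    by (auto intro!: derivative_eq_intros holomorphic_derivI[OF hol _ z(1)]
          holomorphic_derivI[OF holomorphic_deriv[OF hol] _ z(1)] simp: nz)
  then have "(Q_ST f has_field_derivative
           ((deriv f z + z * deriv (deriv f) z) * f z - z * deriv f z * deriv f z) / (f z * f z)) (at z)"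
    by (rule has_field_derivative_transform_within_open[where S = "ball 0 1 - {0}"])
       (use z in \<open>auto simp: Q_ST_def\<close>)
  then show ?thesis
    using nz z by (simp add: Q_CV_def Q_ST_def DERIV_imp_deriv divide_simps algebra_simps)
qed

text \<open>
  With \<open>N = f'' / f'\<close>, \<open>Q_CV f = 1 + z N\<close> and the Schwarzian is \<open>N' - N\<^sup>2 / 2\<close>; eliminate \<open>N\<close>.
\<close>

lemma Q_SD_in_terms_of_Q_CV:
  assumes f: "f \<in> normalized_analytic" and ff': "\<forall>z \<in> ball 0 1. ff'_over_z f z \<noteq> 0"
    and z: "z \<in> ball 0 1"
  shows "Q_SD f z = z * deriv (Q_CV f) z + (1 - (Q_CV f z)\<^sup>2) / 2"
proof -
  define N where "N = (\<lambda>z. deriv (deriv f) z / deriv f z)"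
  have hol: "f holomorphic_on ball 0 1"
    using f by (auto simp: normalized_analytic_def)
  have "N holomorphic_on ball 0 1"
    unfolding N_def by (intro holomorphic_intros hol) (use deriv_f_nonzero[OF f ff'] in auto)
  then have N: "(N has_field_derivative deriv N z) (at z)"
    by (rule holomorphic_derivI) (use z in auto)
  have Q_CV: "Q_CV f = (\<lambda>z. 1 + z * N z)"
    by (auto simp: Q_CV_def N_def)
  have "deriv (Q_CV f) z = N z + z * deriv N z"
    unfolding Q_CV by (rule DERIV_imp_deriv) (auto intro!: derivative_eq_intros N)
  moreover have "Q_SD f z = z\<^sup>2 * (deriv N z - (N z)\<^sup>2 / 2)"
    by (simp add: Q_SD_def schwarzian_def N_def)
  ultimately show ?thesis
    by (simp add: Q_CV power2_eq_square field_simps)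
qed

text \<open>
  Differentiating \<open>Q_CV f = p + z p' / p\<close> for \<open>p = Q_ST f\<close> gives
  \<open>z (Q_CV f)' = t + r / p - (t / p)\<^sup>2\<close> with \<open>r = z p' + z\<^sup>2 p''\<close>. For \<open>p = \<i> s\<close> the first and third
  terms are real, as is \<open>(Q_CV f)\<^sup>2\<close>. The number \<open>y\<close> collects the real terms of \<open>Q_SD f\<close>; its value is
  left open because it will only be divided by imaginary numbers, which makes it invisible to the
  real part.
\<close>

lemma Q_SD_at_imaginary_Q_ST:
  fixes s t :: real
  assumes f: "f \<in> normalized_analytic" and ff': "\<forall>z \<in> ball 0 1. ff'_over_z f z \<noteq> 0"
    and z: "z \<in> ball 0 1" "z \<noteq> 0"
    and s: "Q_ST f z = \<i> * of_real s"
    and t: "z * deriv (Q_ST f) z = of_real t"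
  obtains y where
     "Q_CV f z = \<i> * of_real ((s\<^sup>2 - t) / s)"
     "Q_SD f z = of_real y - \<i> * (z * deriv (Q_ST f) z + z\<^sup>2 * deriv (deriv (Q_ST f)) z) / of_real s"
proof -
  define p where "p = Q_ST f"
  define r where "r = z * deriv p z + z\<^sup>2 * deriv (deriv p) z"
  have p: "p holomorphic_on ball 0 1" and pnz: "p z \<noteq> 0"
    using Q_ST_holomorphic[OF f ff'] z by (auto simp: p_def)
  have pz: "p z = \<i> * of_real s" and tz: "z * deriv p z = of_real t"
    using s t by (auto simp: p_def)
  have s0: "s \<noteq> 0" using pnz pz by auto
  have "((\<lambda>z. p z + z * deriv p z / p z) has_field_derivative
      (deriv p z + ((deriv p z + z * deriv (deriv p) z) * p z - z * deriv p z * deriv p z) / (p z * p z))) (at z)"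
    by (auto intro!: derivative_eq_intros holomorphic_derivI[OF p _ z(1)]
          holomorphic_derivI[OF holomorphic_deriv[OF p] _ z(1)] simp: pnz)
  then have "(Q_CV f has_field_derivative
      (deriv p z + ((deriv p z + z * deriv (deriv p) z) * p z - z * deriv p z * deriv p z) / (p z * p z))) (at z)"
    by (rule has_field_derivative_transform_within_open[where S = "ball 0 1 - {0}"])
       (use z Q_CV_in_terms_of_Q_ST[OF f ff'] in \<open>auto simp: p_def\<close>)
  then have "z * deriv (Q_CV f) z =
      z * (deriv p z + ((deriv p z + z * deriv (deriv p) z) * p z - z * deriv p z * deriv p z) / (p z * p z))"
    by (simp add: DERIV_imp_deriv)
  also have "\<dots> = z * deriv p z + r / p z - (z * deriv p z / p z)\<^sup>2"
    using pnz by (simp add: r_def field_simps power2_eq_square)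
  also have "\<dots> = of_real (t + t\<^sup>2 / s\<^sup>2) - \<i> * r / of_real s"
    unfolding tz pz using s0 by (simp add: field_simps power2_eq_square)
  finally have dC: "z * deriv (Q_CV f) z = of_real (t + t\<^sup>2 / s\<^sup>2) - \<i> * r / of_real s" .
  have "Q_CV f z = p z + z * deriv p z / p z"
    using Q_CV_in_terms_of_Q_ST[OF f ff' z] by (simp add: p_def)
  also have "\<dots> = \<i> * of_real ((s\<^sup>2 - t) / s)"
    unfolding tz pz using s0 by (simp add: field_simps power2_eq_square)
  finally have C: "Q_CV f z = \<i> * of_real ((s\<^sup>2 - t) / s)" .
  have "Q_SD f z = of_real (t + t\<^sup>2 / s\<^sup>2 + (1 + ((s\<^sup>2 - t) / s)\<^sup>2) / 2) - \<i> * r / of_real s"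
    unfolding Q_SD_in_terms_of_Q_CV[OF f ff' z(1)] dC C power_mult_distrib
    by (simp add: add_divide_distrib)
  from that[OF C this[unfolded r_def p_def]] show ?thesis .
qed

text \<open>
  Here \<open>S\<close>, \<open>C\<close>, \<open>D\<close> stand for the values of \<open>Q_ST f\<close>, \<open>Q_CV f\<close>, \<open>Q_SD f\<close> at the boundary point.
  The bound on \<open>t\<close> gives \<open>s\<^sup>2 - t \<ge> (3 s\<^sup>2 + 1) / 2\<close>, which is where the constant \<open>2 / 3\<close> comes from;
  the sign of \<open>Re r\<close> makes the Schwarzian terms contribute at most 0, as \<open>\<beta> \<le> 0\<close>.
\<close>

lemma starlike_bound_violated:
  fixes \<alpha> \<beta> s t y :: real and r S C D :: complex
  assumes "\<alpha> > 0" "\<beta> \<le> 0" "s \<noteq> 0" "2 * t \<le> - (1 + s\<^sup>2)" "Re r \<le> 0"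
    and S: "S = \<i> * of_real s" and C: "C = \<i> * of_real ((s\<^sup>2 - t) / s)"
    and D: "D = of_real y - \<i> * r / of_real s"
  shows "Re (of_real \<alpha> * (S / C) + of_real \<beta> * (D / C)) \<le> 2 * \<alpha> / 3"
    and "Re (of_real \<alpha> * (S / C) + of_real \<beta> * (D / S)) \<le> 2 * \<alpha> / 3"
proof -
  have pos: "s\<^sup>2 - t > 0"
    using assms(4) zero_le_power2[of s] by linarith
  have SC: "S / C = of_real (s\<^sup>2 / (s\<^sup>2 - t))"
    unfolding S C mult_divide_mult_cancel_left[OF complex_i_not_zero] of_real_divide[symmetric]
    using \<open>s \<noteq> 0\<close> by (simp add: power2_eq_square)
  have "s\<^sup>2 / (s\<^sup>2 - t) \<le> 2 / 3"
    using pos assms(4) by (simp add: field_simps)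
  then have "\<alpha> * (s\<^sup>2 / (s\<^sup>2 - t)) \<le> \<alpha> * (2 / 3)"
    using \<open>\<alpha> > 0\<close> by (intro mult_left_mono) auto
  then have main: "\<alpha> * Re (S / C) \<le> 2 * \<alpha> / 3"
    unfolding SC by simp
  have ReD: "Re (D / (\<i> * of_real x)) = - Re r / (s * x)" for x
    by (simp add: D Re_divide Im_divide power2_eq_square field_simps)
  have "Re (D / C) = - Re r / (s\<^sup>2 - t)"
    unfolding C ReD using \<open>s \<noteq> 0\<close> by simp
  then have "Re (D / C) \<ge> 0"
    using pos \<open>Re r \<le> 0\<close> by (simp only:) (intro divide_nonneg_nonneg, auto)
  moreover have "Re (D / S) \<ge> 0"
    unfolding S ReD using \<open>Re r \<le> 0\<close> by (intro divide_nonneg_nonneg) auto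
  ultimately have nonpos: "\<beta> * Re (D / C) \<le> 0" "\<beta> * Re (D / S) \<le> 0"
    using \<open>\<beta> \<le> 0\<close> by (auto simp: mult_nonpos_nonneg)
  have Re_combination: "Re (of_real \<alpha> * u + of_real \<beta> * v) = \<alpha> * Re u + \<beta> * Re v" for u v
    by simp
  show "Re (of_real \<alpha> * (S / C) + of_real \<beta> * (D / C)) \<le> 2 * \<alpha> / 3"
    unfolding Re_combination using main nonpos by linarith
  show "Re (of_real \<alpha> * (S / C) + of_real \<beta> * (D / S)) \<le> 2 * \<alpha> / 3"
    unfolding Re_combination using main nonpos by linarith
qed

theorem theorem2p14:
  fixes \<alpha> \<beta> :: real and f :: "complex \<Rightarrow> complex"
  assumes "\<alpha> > 0" and "\<beta> \<le> 0"
    and "f \<in> normalized_analytic"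
    and "\<forall>z \<in> ball 0 1. ff'_over_z f z \<noteq> 0"
    and "(\<forall>z \<in> ball 0 1. Q_CV f z \<noteq> 0 \<and>
            Re (of_real \<alpha> * (Q_ST f z / Q_CV f z) + of_real \<beta> * (Q_SD f z / Q_CV f z))
              > 2 * \<alpha> / 3)
       \<or> (\<forall>z \<in> ball 0 1. Q_CV f z \<noteq> 0 \<and> Q_ST f z \<noteq> 0 \<and>
            Re (of_real \<alpha> * (Q_ST f z / Q_CV f z) + of_real \<beta> * (Q_SD f z / Q_ST f z))
              > 2 * \<alpha> / 3)"
  shows "starlike_function f"
proof (rule ccontr)
  assume "\<not> starlike_function f"
  then obtain z1 where z1: "z1 \<in> ball 0 1" "Re (Q_ST f z1) \<le> 0"
    using assms(3) by (auto simp: starlike_function_def not_less)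
  note p = Q_ST_holomorphic[OF assms(3,4)]
  have p0: "Q_ST f 0 = 1" by (simp add: Q_ST_def)
  obtain z where z: "z \<in> ball 0 1" "z \<noteq> 0" "Re (Q_ST f z) = 0"
    and inside: "\<And>w. norm w < norm z \<Longrightarrow> Re (Q_ST f w) > 0"
    and closed: "\<And>w. norm w \<le> norm z \<Longrightarrow> Re (Q_ST f w) \<ge> 0"
    using least_modulus_boundary_point[OF p(1) _ z1] p0 by auto
  define s where "s = Im (Q_ST f z)"
  define t where "t = Re (z * deriv (Q_ST f) z)"
  have min: "Re (Q_ST f z) \<le> Re (Q_ST f w)" if "norm w = norm z" for w
    using closed[of w] z(3) that by simp
  have s: "Q_ST f z = \<i> * of_real s"
    using z(3) by (simp add: s_def complex_eq_iff)
  have "s \<noteq> 0"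
    using p(2)[OF z(1)] s by auto
  have t: "z * deriv (Q_ST f) z = of_real t"
    using boundary_point_angular(1)[OF p(1) z(1) min] unfolding t_def complex_eq_iff by simp
  have t_le: "2 * t \<le> - (1 + s\<^sup>2)"
    using boundary_point_radial[OF p(1) p0 z(1,3) inside] by (simp only: s_def t_def)
  obtain y where C: "Q_CV f z = \<i> * of_real ((s\<^sup>2 - t) / s)"
    and D: "Q_SD f z = of_real y - \<i> * (z * deriv (Q_ST f) z + z\<^sup>2 * deriv (deriv (Q_ST f)) z) / of_real s"
    using Q_SD_at_imaginary_Q_ST[OF assms(3,4) z(1,2) s t] by blast
  note violated = starlike_bound_violated[OF assms(1,2) \<open>s \<noteq> 0\<close> t_le
      boundary_point_angular(2)[OF p(1) z(1) min] s C D]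
  show False
    using assms(5) z(1) violated by (meson not_less)
qed

end
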